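(* Let $\Delta\ge 4$ and let $G$ be a finite simple graph in which every node has degree at most $\Delta$. Then the matching $M$ returned by MinGreedy on $G$ satisfies $|M|\ge \frac{2\Delta-1}{4\Delta-4}\,\nu(G)$ for every outcome of its random choices.
   Context: $\nu(G)$ denotes the size of a maximum matching of $G$. MinGreedy maintains a current graph (initially $G$) and a matching $M$ (initially empty); while the current graph has an edge, it chooses a node $u$ uniformly at random among the non-isolated nodes of minimum degree in the current graph, chooses a neighbor $v$ of $u$ in the current graph uniformly at random, adds $\{u,v\}$ to $M$, and deletes $u$, $v$ and all their incident edges. *)

theory Defs
  imports "HOL-Probability.Probability_Mass_Function" "HOL-Library.Disjoint_Sets"
begin

text \<open>A finite simple graph is given by its node set \<open>V\<close> and its edge set \<open>E\<close>, the edges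
  being two-element subsets of \<open>V\<close>.\<close>

definition finite_simple_graph :: "'a set \<Rightarrow> 'a set set \<Rightarrow> bool" where
  "finite_simple_graph V E \<longleftrightarrow> finite V \<and> E \<subseteq> {e. e \<subseteq> V \<and> card e = 2}"

definition neighbors :: "'a set set \<Rightarrow> 'a \<Rightarrow> 'a set" where
  "neighbors E u = {v. {u, v} \<in> E}"

definition node_degree :: "'a set set \<Rightarrow> 'a \<Rightarrow> nat" where
  "node_degree E u = card (neighbors E u)"

definition matching :: "'a set set \<Rightarrow> 'a set set \<Rightarrow> bool" where
  "matching E M \<longleftrightarrow> M \<subseteq> E \<and> disjoint M"

definition matching_number :: "'a set set \<Rightarrow> nat" where
  "matching_number E = Max (card ` {M. matching E M})"

definition non_isolated :: "'a set \<Rightarrow> 'a set set \<Rightarrow> 'a set" where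
  "non_isolated V E = {u \<in> V. neighbors E u \<noteq> {}}"

definition min_degree_nodes :: "'a set \<Rightarrow> 'a set set \<Rightarrow> 'a set" where
  "min_degree_nodes V E =
    {u \<in> non_isolated V E. \<forall>w \<in> non_isolated V E. node_degree E u \<le> node_degree E w}"

definition delete_nodes :: "'a set \<Rightarrow> 'a set set \<Rightarrow> 'a set set" where
  "delete_nodes X E = {e \<in> E. e \<inter> X = {}}"

lemma finite_simple_graph_delete:
  "finite_simple_graph V E \<Longrightarrow> finite_simple_graph (V - X) (delete_nodes X E)"
  by (auto simp: finite_simple_graph_def delete_nodes_def)

lemma finite_min_degree_nodes:
  "finite_simple_graph V E \<Longrightarrow> finite (min_degree_nodes V E)"
  by (simp add: finite_simple_graph_def min_degree_nodes_def non_isolated_def)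

lemma min_degree_nodes_nonempty:
  assumes "finite_simple_graph V E" "E \<noteq> {}"
  shows "min_degree_nodes V E \<noteq> {}"
proof -
  from assms(2) obtain e where e: "e \<in> E" by blast
  with assms(1) have "card e = 2" "e \<subseteq> V" by (auto simp: finite_simple_graph_def)
  then obtain x y where "e = {x, y}" "x \<in> V" by (auto simp: card_2_iff)
  with e have "x \<in> non_isolated V E" by (auto simp: non_isolated_def neighbors_def)
  then obtain u where "is_arg_min (node_degree E) (\<lambda>u. u \<in> non_isolated V E) u"
    using ex_has_least_nat[of "\<lambda>u. u \<in> non_isolated V E" x "node_degree E"]
    by (auto simp: is_arg_min_linorder)
  then show ?thesis by (auto simp: min_degree_nodes_def is_arg_min_linorder)
qed

lemma finite_neighbors:
  assumes "finite_simple_graph V E"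
  shows "finite (neighbors E u)"
proof (rule finite_subset)
  show "neighbors E u \<subseteq> V" using assms by (auto simp: finite_simple_graph_def neighbors_def)
  show "finite V" using assms by (simp add: finite_simple_graph_def)
qed

text \<open>The distribution of the matching returned by MinGreedy when continued from the current
  graph \<open>(V, E)\<close> and the current matching \<open>M\<close>. The test \<open>finite_simple_graph V E\<close> only serves
  to make the function total: node deletion preserves it
  (\<open>finite_simple_graph_delete\<close>). It also ensures that \<open>pmf_of_set\<close> is only ever
  applied to finite nonempty sets.\<close>

function mingreedy_from :: "'a set \<Rightarrow> 'a set set \<Rightarrow> 'a set set \<Rightarrow> 'a set set pmf" where
  "mingreedy_from V E M =
    (if finite_simple_graph V E \<and> E \<noteq> {} then
       bind_pmf (pmf_of_set (min_degree_nodes V E)) (\<lambda>u.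
       bind_pmf (pmf_of_set (neighbors E u)) (\<lambda>v.
       mingreedy_from (V - {u, v}) (delete_nodes {u, v} E) (insert {u, v} M)))
     else return_pmf M)"
  by pat_completeness auto
termination
proof (relation "Wellfounded.measure (\<lambda>(V, E, M). card V)", goal_cases)
  case 1
  show ?case by simp
next
  case (2 V E M u v)
  then have g: "finite_simple_graph V E" and "E \<noteq> {}" by auto
  then have "set_pmf (pmf_of_set (min_degree_nodes V E)) = min_degree_nodes V E"
    by (intro set_pmf_of_set min_degree_nodes_nonempty finite_min_degree_nodes)
  with 2 have "u \<in> V" by (simp add: min_degree_nodes_def non_isolated_def)
  moreover from g have "finite V" by (simp add: finite_simple_graph_def)
  ultimately show ?case by (auto intro!: psubset_card_mono)
qed

declare mingreedy_from.simps [simp del]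

definition mingreedy :: "'a set \<Rightarrow> 'a set set \<Rightarrow> 'a set set pmf" where
  "mingreedy V E = mingreedy_from V E {}"

end

theory Submission
  imports Defs
begin

text \<open>
  Let \<open>d = \<Delta> - 1\<close>, let \<open>M\<close> be the computed and \<open>M\<^sup>*\<close> a maximum matching.  Call a node
  covered by \<open>M\<close> free if its \<open>M\<^sup>*\<close>-partner is missed by \<open>M\<close>.  The claim says that
  the free nodes, at cost \<open>1\<close> each, can be paid for if every \<open>M\<^sup>*\<close>-edge with both ends covered
  earns \<open>2d - 1\<close> and every covered node missed by \<open>M\<^sup>*\<close> earns \<open>2d\<close>.  Only a pick with two free
  ends cannot pay locally.  Its cost is handed to the two \<open>M\<close>-missed partners, which pass it on
  along the edges they still have to nodes picked later.  Since such a pick has minimum degree at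
  least two, the last of these edges disappears either in a pick of a degree-one node, whose other
  end has at most \<open>d\<close> further neighbors, or in a pick with enough surplus.  A degree-one pick can
  be short by at most \<open>1\<close>; then at least \<open>d - 1\<close> missed nodes with demand \<open>2\<close> were
  reduced to degree one by the last preceding pick of minimum degree at least two, and
  counting the neighbors of that pick shows that it or its successor has a
  surplus.  As \<open>2 (d - 1) > d\<close>, this surplus is claimed only once.
\<close>

section \<open>Abstract greedy runs: current degrees, weights, demands and loads\<close>

locale greedy_run =
  fixes V :: "'a set" and N :: "'a \<Rightarrow> 'a set" and n d :: nat
    \<comment> \<open>\<open>\<tau> a\<close> is the number of the pick deleting \<open>a\<close>, and \<open>n\<close> if \<open>a\<close> is never matched;
      \<open>mt a\<close> is the \<open>M\<^sup>*\<close>-partner of \<open>a\<close>, and \<open>a\<close> itself if there is none.\<close>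
    and \<tau> :: "'a \<Rightarrow> nat" and u v :: "nat \<Rightarrow> 'a" and mt :: "'a \<Rightarrow> 'a"
  assumes finite_V: "finite V"
    and N_subset: "N a \<subseteq> V"
    and N_sym: "b \<in> N a \<Longrightarrow> a \<in> N b"
    and N_card: "card (N a) \<le> Suc d"
    and d_ge: "3 \<le> d"
    and \<tau>_le: "a \<in> V \<Longrightarrow> \<tau> a \<le> n"
    and u_neq_v: "i < n \<Longrightarrow> u i \<noteq> v i"
    and v_in_N_u: "i < n \<Longrightarrow> v i \<in> N (u i)"
    and \<tau>_pick: "i < n \<Longrightarrow> {a \<in> V. \<tau> a = i} = {u i, v i}"
    and unmatched_indep: "b \<in> N a \<Longrightarrow> \<tau> a = n \<Longrightarrow> \<tau> b < n"
    and greedy: "i < n \<Longrightarrow> i \<le> \<tau> a \<Longrightarrow> b \<in> N a \<Longrightarrow> i \<le> \<tau> b \<Longrightarrow>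
      card {b \<in> N (u i). i \<le> \<tau> b} \<le> card {b \<in> N a. i \<le> \<tau> b}"
    and mt_mt: "mt (mt a) = a"
    and mt_in_N: "mt a \<noteq> a \<Longrightarrow> mt a \<in> N a"
begin

text \<open>Nodes with \<open>\<tau> b \<ge> i\<close> have not been deleted before pick
  \<open>i\<close>, so for a surviving node \<open>a\<close> this is its neighborhood in the current
  graph.\<close>

definition nb :: "nat \<Rightarrow> 'a \<Rightarrow> 'a set" where
  "nb i a = {b \<in> N a. i \<le> \<tau> b}"

definition dg :: "nat \<Rightarrow> 'a \<Rightarrow> nat" where
  "dg i a = card (nb i a)"

text \<open>Since \<open>u i\<close> has minimum degree, at any other pick every non-isolated node
  of the current graph has degree at least two.\<close>

definition leaf :: "nat \<Rightarrow> bool" where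
  "leaf i \<longleftrightarrow> dg i (u i) = 1"

definition W :: "'a set" where
  "W = {a \<in> V. \<tau> a = n}"

definition free :: "'a \<Rightarrow> bool" where
  "free a \<longleftrightarrow> \<tau> (mt a) = n"

definition has_free :: "nat \<Rightarrow> bool" where
  "has_free i \<longleftrightarrow> free (u i) \<or> free (v i)"

text \<open>The picks with two free ends: one edge of \<open>M\<close> spoils two edges of
  \<open>M\<^sup>*\<close>.\<close>

definition half :: "nat \<Rightarrow> bool" where
  "half i \<longleftrightarrow> free (u i) \<and> free (v i)"

text \<open>In a half pick, \<open>mt (u i)\<close> may be left without edges to pass its unit on; then
  \<open>mt (v i)\<close> takes over both units.  The unit given to partners of other free nodes is needed when
  the pick deleting them has to lend its surplus (\<open>critical_credit\<close>).\<close>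

definition demand :: "'a \<Rightarrow> nat" where
  "demand w = (let i = \<tau> (mt w) in
     if mt w = w \<or> dg (Suc i) w = 0 then 0
     else if half i \<and> dg (Suc i) (mt (u i)) = 0 then 2 else 1)"

text \<open>The \<open>2d - 1\<close> units of an \<open>M\<^sup>*\<close>-edge go to the later of its ends, which may have
  degree one when picked, except for one unit that pays for a free node next to the earlier end.\<close>

definition weight :: "'a \<Rightarrow> int" where
  "weight a =
    (if free a then int (demand (mt a)) - 1
     else if mt a = a then 2 * int d
     else if \<tau> (mt a) = \<tau> a then (if a = u (\<tau> a) then 2 * int d - 1 else 0)
     else if \<tau> (mt a) < \<tau> a then 2 * int d - 1 - of_bool (has_free (\<tau> (mt a)))
     else of_bool (has_free (\<tau> a)))"

text \<open>\<open>T\<close> is the last pick before \<open>i\<close> with minimum degree at least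
  two; \<open>i\<close> itself may be of either kind.\<close>

definition phase :: "nat \<Rightarrow> nat \<Rightarrow> bool" where
  "phase T i \<longleftrightarrow> T < i \<and> \<not> leaf T \<and> (\<forall>j. T < j \<and> j < i \<longrightarrow> leaf j)"

text \<open>A node that still has two edges after pick \<open>T\<close> can split its demand over two degree-one
  picks; the urgent nodes are those that cannot.\<close>

definition urgent :: "'a \<Rightarrow> nat \<Rightarrow> bool" where
  "urgent w i \<longleftrightarrow> demand w = 2 \<and> (\<exists>T. phase T i \<and> dg (Suc T) w = 1 \<and> \<tau> (mt w) \<le> T)"

text \<open>A load splits the demand of \<open>w\<close> among later picks adjacent to
  \<open>w\<close>. A pick of minimum degree at least two may be charged only if it removes the last
  edges of \<open>w\<close>, which forces \<open>w\<close> next to both ends. A degree-one pick may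
  be charged twice only by urgent nodes, which are scarce.\<close>

definition is_load :: "'a \<Rightarrow> (nat \<Rightarrow> nat) \<Rightarrow> bool" where
  "is_load w f \<longleftrightarrow> (\<Sum>i<n. f i) = demand w \<and>
    (\<forall>i<n. (0 < f i \<longrightarrow> \<tau> (mt w) < i \<and> (u i \<in> N w \<or> v i \<in> N w)) \<and> f i \<le> 2 \<and>
       (0 < f i \<and> \<not> leaf i \<longrightarrow> dg (Suc i) w = 0) \<and>
       (leaf i \<and> 2 \<le> f i \<longrightarrow> urgent w i))"

lemma phase_unique: "phase T i \<Longrightarrow> phase T' i \<Longrightarrow> T = T'"
  unfolding phase_def by (metis linorder_neqE_nat)

lemma finite_N: "finite (N a)"
  using N_subset finite_V finite_subset by blast

lemma finite_nb: "finite (nb i a)"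
  by (simp add: nb_def finite_N)

lemma pick_props:
  assumes "i < n"
  shows "u i \<in> V" "v i \<in> V" "\<tau> (u i) = i" "\<tau> (v i) = i" "u i \<in> N (v i)"
  using \<tau>_pick[OF assms] v_in_N_u[OF assms] N_sym by blast+

lemma in_pick: "a \<in> V \<Longrightarrow> \<tau> a < n \<Longrightarrow> a = u (\<tau> a) \<or> a = v (\<tau> a)"
  using \<tau>_pick[of "\<tau> a"] by blast

lemma N_in_V: "b \<in> N a \<Longrightarrow> a \<in> V \<and> b \<in> V"
  using N_subset N_sym by blast

lemma mt_in_V: "a \<in> V \<Longrightarrow> mt a \<in> V"
  by (metis N_in_V mt_in_N)

lemma dg_le: "i < n \<Longrightarrow> i \<le> \<tau> a \<Longrightarrow> b \<in> nb i a \<Longrightarrow> dg i (u i) \<le> dg i a"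
  unfolding dg_def nb_def using greedy by blast

lemma v_in_nb: "i < n \<Longrightarrow> v i \<in> nb i (u i)"
  by (simp add: nb_def v_in_N_u pick_props)

lemma u_in_nb: "i < n \<Longrightarrow> u i \<in> nb i (v i)"
  by (simp add: nb_def pick_props)

lemma dg_u_pos: "i < n \<Longrightarrow> 0 < dg i (u i)"
  unfolding dg_def using v_in_nb finite_nb by (metis card_gt_0_iff empty_iff)

lemma not_leaf_iff: "i < n \<Longrightarrow> \<not> leaf i \<longleftrightarrow> 2 \<le> dg i (u i)"
  unfolding leaf_def using dg_u_pos[of i] by linarith

lemma nb_leaf: "i < n \<Longrightarrow> leaf i \<Longrightarrow> nb i (u i) = {v i}"
  unfolding leaf_def dg_def using v_in_nb by (metis card_1_singletonE singletonD)

lemma nb_split: "i < n \<Longrightarrow> nb i a = nb (Suc i) a \<union> (N a \<inter> {u i, v i})"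
  unfolding nb_def using in_pick N_in_V pick_props by (auto simp: Suc_le_eq order_le_less)

lemma dg_split:
  assumes "i < n"
  shows "dg i a = dg (Suc i) a + card (N a \<inter> {u i, v i})"
proof -
  have "nb (Suc i) a \<inter> (N a \<inter> {u i, v i}) = {}"
    using pick_props[OF assms] by (auto simp: nb_def)
  then show ?thesis
    unfolding dg_def nb_split[OF assms, of a] using finite_nb by (intro card_Un_disjoint) auto
qed

lemma card_pick_le: "card (N a \<inter> {u i, v i}) \<le> 2"
  by (rule order.trans[OF card_mono[of "{u i, v i}"]]) (auto simp: card_insert_if)

lemma card_pick_le1:
  "\<not> (u i \<in> N a \<and> v i \<in> N a) \<Longrightarrow> card (N a \<inter> {u i, v i}) \<le> 1"
  by (cases "u i \<in> N a"; cases "v i \<in> N a") auto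

section \<open>Free nodes, half picks and the loads they cause\<close>

lemma free_mt: "a \<in> V \<Longrightarrow> \<tau> a < n \<Longrightarrow> free a \<Longrightarrow> mt a \<noteq> a \<and> mt a \<in> N a \<and> mt a \<in> W"
  unfolding free_def W_def using mt_in_N[of a] mt_in_V by fastforce

lemma free_in_nb: "a \<in> V \<Longrightarrow> \<tau> a < n \<Longrightarrow> free a \<Longrightarrow> i < n \<Longrightarrow> mt a \<in> nb i a"
  using free_mt by (fastforce simp: nb_def W_def)

lemma W_mt: "w \<in> W \<Longrightarrow> mt w \<noteq> w \<Longrightarrow> mt w \<in> V \<and> \<tau> (mt w) < n \<and> free (mt w)"
  using mt_mt[of w] mt_in_N[of w] mt_in_V[of w] unmatched_indep[of "mt w" w]
  by (simp add: free_def W_def)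

text \<open>A partner missed by \<open>M\<close> is never deleted, so it would be a second current
  neighbor of \<open>u i\<close> besides \<open>v i\<close>.\<close>

lemma leaf_not_free: "i < n \<Longrightarrow> leaf i \<Longrightarrow> \<not> free (u i)"
  using nb_leaf[of i] free_in_nb[of "u i" i] pick_props[of i] by (auto simp: free_def)

lemma half_not_leaf: "i < n \<Longrightarrow> half i \<Longrightarrow> \<not> leaf i"
  using leaf_not_free half_def by blast

text \<open>If the partner of one end is isolated by the pick, minimum degree at least two makes it
  adjacent to both ends, with minimum degree exactly two. For the partner of \<open>v i\<close> this
  is impossible: \<open>u i\<close> would have the three neighbors \<open>v i\<close>,
  \<open>mt (u i)\<close> and \<open>mt (v i)\<close>. So only \<open>mt (u i)\<close> can be unable
  to pass its unit on.\<close>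

lemma half_facts:
  assumes i: "i < n" and h: "half i"
  shows "mt (u i) \<noteq> mt (v i)" "mt (v i) \<in> W" "mt (u i) \<in> W"
    and "0 < dg (Suc i) (mt (v i))"
    and "dg (Suc i) (mt (u i)) = 0 \<Longrightarrow> mt (u i) \<in> N (v i)"
proof -
  note p = pick_props[OF i]
  have fu: "free (u i)" and fv: "free (v i)" using h by (auto simp: half_def)
  show ne: "mt (u i) \<noteq> mt (v i)" using mt_mt u_neq_v[OF i] by metis
  show Wv: "mt (v i) \<in> W" and Wu: "mt (u i) \<in> W" using free_mt p fu fv i by auto
  have nl: "2 \<le> dg i (u i)" using half_not_leaf[OF i h] not_leaf_iff[OF i] by simp
  have both: "u i \<in> N (mt a) \<and> v i \<in> N (mt a) \<and> dg i (u i) = 2"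
    if a: "a = u i \<or> a = v i" and z: "dg (Suc i) (mt a) = 0" for a
  proof -
    have "mt a \<in> N a" "\<tau> (mt a) = n" using a free_mt p fu fv i by (auto simp: W_def)
    then have "a \<in> nb i (mt a)" "i \<le> \<tau> (mt a)" using a p i N_sym by (auto simp: nb_def)
    then have "dg i (u i) \<le> dg i (mt a)" using dg_le i by blast
    then have "2 \<le> card (N (mt a) \<inter> {u i, v i})" "dg i (u i) \<le> card (N (mt a) \<inter> {u i, v i})"
      using nl dg_split[OF i, of "mt a"] z by auto
    then show ?thesis using card_pick_le1[of i "mt a"] card_pick_le[of "mt a" i] nl by fastforce
  qed
  show "mt (u i) \<in> N (v i)" if "dg (Suc i) (mt (u i)) = 0" using both[OF _ that] N_sym by blast
  show "0 < dg (Suc i) (mt (v i))"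
  proof (rule ccontr)
    assume "\<not> 0 < dg (Suc i) (mt (v i))"
    then have b: "u i \<in> N (mt (v i))" "dg i (u i) = 2" using both[of "v i"] by auto
    have "{v i, mt (u i), mt (v i)} \<subseteq> nb i (u i)"
      using v_in_nb[OF i] free_in_nb[OF p(1) _ fu i] p i b(1) N_sym Wv by (auto simp: nb_def W_def)
    then have "card {v i, mt (u i), mt (v i)} \<le> 2"
      using card_mono[OF finite_nb] b(2) unfolding dg_def by metis
    moreover have "mt (u i) \<noteq> v i" "mt (v i) \<noteq> v i" using Wu Wv p i by (auto simp: W_def)
    ultimately show False using ne by (auto simp: card_insert_if)
  qed
qed

lemma demand_le: "demand w \<le> 2"
  by (simp add: demand_def Let_def)

lemma demand_2:
  assumes "w \<in> W" "demand w = 2"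
  shows "mt w \<noteq> w" "half (\<tau> (mt w))" "\<tau> (mt w) < n" "w = mt (v (\<tau> (mt w)))"
    "dg (Suc (\<tau> (mt w))) (mt (u (\<tau> (mt w)))) = 0"
proof -
  show a: "mt w \<noteq> w" "half (\<tau> (mt w))"
    and z: "dg (Suc (\<tau> (mt w))) (mt (u (\<tau> (mt w)))) = 0"
    using assms(2) by (auto simp: demand_def Let_def split: if_splits)
  have nz: "dg (Suc (\<tau> (mt w))) w \<noteq> 0"
    using assms(2) by (auto simp: demand_def Let_def split: if_splits)
  show l: "\<tau> (mt w) < n" using W_mt assms(1) a by blast
  have "mt w = u (\<tau> (mt w)) \<or> mt w = v (\<tau> (mt w))" using in_pick W_mt assms(1) a by blast
  then show "w = mt (v (\<tau> (mt w)))" using z nz mt_mt by metis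
qed

text \<open>The weights of two free ends are these demands minus one each, so a half pick has total
  weight zero.\<close>

lemma demand_half:
  assumes "i < n" "half i"
  shows "demand (mt (u i)) + demand (mt (v i)) = 2"
proof -
  have "mt (u i) \<noteq> u i" "mt (v i) \<noteq> v i" using half_facts[OF assms] pick_props[OF assms(1)] assms(1)
    by (auto simp: W_def)
  then have "mt (mt (u i)) \<noteq> mt (u i)" "mt (mt (v i)) \<noteq> mt (v i)" using mt_mt by metis+
  then show ?thesis
    using half_facts(4)[OF assms] assms pick_props[OF assms(1)] by (simp add: demand_def Let_def mt_mt)
qed

text \<open>Let \<open>e\<close> be the pick that removes the last edge of \<open>w\<close>; it
  normally takes the whole demand. If \<open>e\<close> is a degree-one pick and two units are due
  without urgency, \<open>w\<close> has at least two edges after the last pick \<open>T\<close> of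
  higher minimum degree. They disappear at different degree-one picks after \<open>T\<close>, and
  two of these get one unit each.\<close>

lemma load_exists:
  assumes w: "w \<in> W"
  shows "\<exists>f. is_load w f"
proof (cases "demand w = 0")
  case True
  then show ?thesis by (intro exI[of _ "\<lambda>_. 0"]) (auto simp: is_load_def)
next
  case False
  define i0 where "i0 = \<tau> (mt w)"
  define e where "e = Max (\<tau> ` N w)"
  have mw: "mt w \<noteq> w" and pos: "0 < dg (Suc i0) w"
    using False by (auto simp: demand_def Let_def i0_def split: if_splits)
  then obtain b0 where b0: "b0 \<in> nb (Suc i0) w" unfolding dg_def
    by (metis card.empty ex_in_conv less_irrefl)
  have max: "\<tau> b \<le> e" if "b \<in> N w" for b using that finite_N unfolding e_def by simp
  have "e \<in> \<tau> ` N w" unfolding e_def using b0 finite_N by (intro Max_in) (auto simp: nb_def)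
  then obtain c where c: "c \<in> N w" "\<tau> c = e" by auto
  have en: "e < n" using c unmatched_indep w by (auto simp: W_def)
  have i0e: "i0 < e" using b0 max by (force simp: nb_def)
  have adj: "u (\<tau> b) \<in> N w \<or> v (\<tau> b) \<in> N w" if "b \<in> N w" for b
    using that in_pick[of b] unmatched_indep[OF that] N_in_V[OF that] w by (auto simp: W_def)
  have "nb (Suc e) w = {}" using max by (fastforce simp: nb_def)
  then have last: "dg (Suc e) w = 0" by (simp add: dg_def)
  have one: "\<exists>f. is_load w f"
    if ur: "demand w \<noteq> 2 \<or> \<not> leaf e \<or> urgent w e"
    unfolding is_load_def
  proof (intro exI[of _ "\<lambda>i. if i = e then demand w else 0"] conjI allI impI)
    show "(\<Sum>i<n. if i = e then demand w else 0) = demand w" using en by simp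
  qed (use demand_le[of w] ur last mw adj[OF c(1)] i0e c(2) in \<open>auto simp: i0_def split: if_splits\<close>)
  show ?thesis
  proof (cases "demand w \<noteq> 2 \<or> \<not> leaf e \<or> urgent w e")
    case True
    then show ?thesis by (rule one)
  next
    case nu: False
    then have D2: "demand w = 2" and le: "leaf e" and nur: "\<not> urgent w e" by auto
    have nl0: "\<not> leaf i0" using demand_2[OF w D2] half_not_leaf unfolding i0_def by blast
    \<comment> \<open>The set is nonempty: demand two comes from a half pick \<open>i0\<close>,
      which is not a degree-one pick.\<close>
    define T where "T = Max {j. j < e \<and> \<not> leaf j}"
    have fin: "finite {j. j < e \<and> \<not> leaf j}" by simp
    have "T \<in> {j. j < e \<and> \<not> leaf j}" unfolding T_def using nl0 i0e by (intro Max_in) auto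
    moreover have Tmax: "j \<le> T" if "j < e" "\<not> leaf j" for j using that fin unfolding T_def by simp
    ultimately have ph: "phase T e" by (metis (mono_tags, lifting) leD mem_Collect_eq phase_def)
    then have Te: "T < e" by (simp add: phase_def)
    have i0T: "i0 \<le> T" using Tmax nl0 i0e by blast
    have "dg (Suc T) w \<noteq> 1" using nur ph D2 i0T unfolding urgent_def i0_def by blast
    moreover have cT: "c \<in> nb (Suc T) w" using c Te by (simp add: nb_def)
    moreover have "nb (Suc T) w \<noteq> {c}" using calculation(1) by (auto simp: dg_def)
    ultimately obtain b where b: "b \<in> nb (Suc T) w" "b \<noteq> c" by blast
    \<comment> \<open>In a degree-one pick \<open>u e\<close> has no current neighbor but
      \<open>v e\<close>, so \<open>w\<close> loses just one edge there and its other edge goes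
      earlier.\<close>
    have only: "x = v e" if "x \<in> N w" "\<tau> x = e" for x
    proof -
      have "w \<notin> nb e (u e)" using nb_leaf[OF en le] w pick_props[OF en] en by (auto simp: W_def)
      then have "u e \<notin> N w" using w en N_sym by (auto simp: nb_def W_def)
      then show ?thesis using in_pick[of x] that en N_in_V by auto
    qed
    have be: "\<tau> b \<noteq> e" using only b c by (metis (mono_tags, lifting) mem_Collect_eq nb_def)
    then have be': "\<tau> b < e" using max b by (force simp: nb_def)
    then have lb: "leaf (\<tau> b)" using ph b unfolding phase_def nb_def by auto
    have bN: "b \<in> N w" and bT: "T < \<tau> b" using b by (auto simp: nb_def)
    show ?thesis
      unfolding is_load_def
    proof (intro exI[of _ "\<lambda>i. (if i = e then 1 else 0) + (if i = \<tau> b then 1 else 0)"] conjI allI impI)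
      show "(\<Sum>i<n. (if i = e then 1 else 0) + (if i = \<tau> b then 1 else 0)) = demand w"
        using en be' D2 by (simp add: sum.distrib)
    qed (use be lb le mw adj[OF c(1)] adj[OF bN] i0e i0T bT c(2) in \<open>auto simp: i0_def split: if_splits\<close>)
  qed
qed

end

section \<open>Surplus of a single pick for a fixed choice of loads\<close>

locale loaded_run = greedy_run V N n d \<tau> u v mt
  for V :: "'a set" and N n d \<tau> u v mt +
  fixes load :: "'a \<Rightarrow> nat \<Rightarrow> nat"
  assumes is_load: "w \<in> W \<Longrightarrow> is_load w (load w)"
begin

lemma l_sum: "w \<in> W \<Longrightarrow> (\<Sum>i<n. load w i) = demand w"
  and l_adj: "w \<in> W \<Longrightarrow> i < n \<Longrightarrow> 0 < load w i \<Longrightarrow> \<tau> (mt w) < i \<and> (u i \<in> N w \<or> v i \<in> N w)"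
  and l_le: "w \<in> W \<Longrightarrow> i < n \<Longrightarrow> load w i \<le> 2"
  and l_nonleaf: "w \<in> W \<Longrightarrow> i < n \<Longrightarrow> 0 < load w i \<Longrightarrow> \<not> leaf i \<Longrightarrow> dg (Suc i) w = 0"
  and l_urgent: "w \<in> W \<Longrightarrow> i < n \<Longrightarrow> leaf i \<Longrightarrow> 2 \<le> load w i \<Longrightarrow> urgent w i"
  using is_load unfolding is_load_def by blast+

definition slack :: "nat \<Rightarrow> int" where
  "slack i = weight (u i) + weight (v i) - int (\<Sum>w\<in>W. load w i)"

definition loaded :: "nat \<Rightarrow> 'a set" where
  "loaded i = {w \<in> W. 0 < load w i}"

definition heavy :: "nat \<Rightarrow> 'a set" where
  "heavy i = {w \<in> W. 2 \<le> load w i}"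

text \<open>The survivors of pick \<open>i\<close> that lose an edge through it.\<close>

definition outer :: "nat \<Rightarrow> 'a set" where
  "outer i = (nb i (u i) \<union> nb i (v i)) - {u i, v i}"

lemma finite_W: "finite W" "finite (loaded i)" "finite (heavy i)" "finite (outer i)"
  using finite_V by (simp_all add: W_def loaded_def heavy_def outer_def finite_nb)

lemma card_heavy_loaded: "card (heavy i) \<le> card (loaded i)"
  using finite_W by (intro card_mono) (auto simp: heavy_def loaded_def)

lemma load_le:
  assumes "i < n"
  shows "(\<Sum>w\<in>W. load w i) \<le> card (loaded i) + card (heavy i)"
proof -
  have "(\<Sum>w\<in>W. load w i) \<le> (\<Sum>w\<in>W. of_bool (0 < load w i) + of_bool (2 \<le> load w i))"
    using l_le[OF _ assms] by (intro sum_mono) (fastforce simp: le_Suc_eq numeral_2_eq_2)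
  also have "\<dots> = card (loaded i) + card (heavy i)"
    using finite_W(1) by (simp add: sum.distrib sum_of_bool_eq loaded_def heavy_def Int_def)
  finally show ?thesis .
qed

lemma weight_ge: "- 1 \<le> weight a" "\<not> free a \<Longrightarrow> 0 \<le> weight a"
  using d_ge by (auto simp: weight_def)

text \<open>A loaded node must touch the pick, and \<open>u i\<close> has only the neighbor
  \<open>v i\<close>. The partner of \<open>v i\<close> is excluded because the partner of a loaded
  node was picked strictly earlier.\<close>

lemma loaded_leaf:
  assumes "i < n" "leaf i"
  shows "loaded i \<subseteq> N (v i) - {u i} - {mt (v i)}"
proof
  fix w assume w: "w \<in> loaded i"
  then have W: "w \<in> W" "0 < load w i" by (auto simp: loaded_def)
  note p = pick_props[OF assms(1)] and a = l_adj[OF W(1) assms(1) W(2)]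
  have "w \<notin> nb i (u i)" using nb_leaf[OF assms] W p assms by (auto simp: W_def)
  then have "u i \<notin> N w" using W assms(1) N_sym by (auto simp: nb_def W_def)
  then show "w \<in> N (v i) - {u i} - {mt (v i)}" using a N_sym p assms W mt_mt by (auto simp: W_def)
qed

lemma card_loaded_leaf:
  assumes "i < n" "leaf i"
  shows "card (loaded i) \<le> d" "mt (v i) \<noteq> v i \<Longrightarrow> mt (v i) \<noteq> u i \<Longrightarrow> card (loaded i) + 1 \<le> d"
proof -
  have "card (loaded i) \<le> card (N (v i) - {u i} - {mt (v i)})"
    using loaded_leaf[OF assms] finite_N by (intro card_mono) auto
  moreover have "card (N (v i) - {u i}) = card (N (v i)) - 1"
    using pick_props[OF assms(1)] finite_N by simp
  moreover have "card (N (v i) - {u i} - {mt (v i)}) \<le> card (N (v i) - {u i})"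
    using finite_N by (intro card_mono) auto
  ultimately show "card (loaded i) \<le> d" using N_card[of "v i"] by linarith
  assume "mt (v i) \<noteq> v i" "mt (v i) \<noteq> u i"
  then have "{u i, mt (v i)} \<subseteq> N (v i)" "card {u i, mt (v i)} = 2"
    using pick_props[OF assms(1)] mt_in_N by auto
  then have "card (N (v i) - {u i, mt (v i)}) + 2 = card (N (v i))"
    using finite_N by (metis add.commute card_Diff_subset card_mono finite.emptyI finite_insert
        le_add_diff_inverse)
  moreover have "N (v i) - {u i} - {mt (v i)} = N (v i) - {u i, mt (v i)}" by auto
  ultimately show "card (loaded i) + 1 \<le> d"
    using N_card[of "v i"] \<open>card (loaded i) \<le> card (N (v i) - {u i} - {mt (v i)})\<close> by simp
qed

text \<open>The hypothesis holds both for degree-one picks and for loaded picks of higher minimum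
  degree; in either situation it makes \<open>u i\<close> the main earner of the pick.\<close>

lemma min_degree_mate_cases:
  assumes "i < n" "mt (u i) \<notin> nb i (u i) - {v i}"
  shows "\<not> free (u i)" "mt (u i) = u i \<or> mt (u i) = v i \<or> (mt (u i) \<noteq> u i \<and> \<tau> (mt (u i)) < i)"
proof -
  note p = pick_props[OF assms(1)]
  show "\<not> free (u i)"
    using free_in_nb[of "u i" i] p(1,3,4) assms
    by (metis DiffI free_def nat_neq_iff singletonD)
  show "mt (u i) = u i \<or> mt (u i) = v i \<or> (mt (u i) \<noteq> u i \<and> \<tau> (mt (u i)) < i)"
    using assms(2) mt_in_N[of "u i"] by (fastforce simp: nb_def)
qed

lemma weight_u_cases:
  assumes i: "i < n" and nf: "\<not> free (u i)"
    and c: "mt (u i) = u i \<or> mt (u i) = v i \<or> (mt (u i) \<noteq> u i \<and> \<tau> (mt (u i)) < i)"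
  obtains (C) "weight (u i) = 2 * int d" "mt (v i) \<noteq> u i"
    | (single) "weight (u i) = 2 * int d - 1" "weight (v i) = 0" "mt (v i) = u i"
    | (later) "weight (u i) = 2 * int d - 1 - of_bool (has_free (\<tau> (mt (u i))))" "\<tau> (mt (u i)) < i"
        "mt (v i) \<noteq> u i"
proof -
  note p = pick_props[OF i]
  consider "mt (u i) = u i" | "mt (u i) = v i" | "mt (u i) \<noteq> u i" "\<tau> (mt (u i)) < i" using c by blast
  then show thesis
  proof cases
    case 1
    then have "mt (v i) \<noteq> u i" using mt_mt u_neq_v[OF i] by metis
    then show ?thesis using 1 nf by (intro C) (auto simp: weight_def)
  next
    case 2
    then have "mt (v i) = u i" using mt_mt by metis
    then show ?thesis using 2 nf p u_neq_v[OF i] i by (intro single) (auto simp: weight_def free_def)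
  next
    case 3
    then have "mt (v i) \<noteq> u i" using mt_mt p by (metis less_irrefl)
    then show ?thesis using 3 nf p by (intro later) (auto simp: weight_def)
  qed
qed

text \<open>\<open>u i\<close> is not free and brings at least \<open>2 * d - 2\<close>. If
  \<open>v i\<close> has a partner other than \<open>u i\<close>, it may cost one unit, but that
  partner is not loaded, so at most \<open>d - 1\<close> nodes are. Hence a deficit is at most one,
  and it needs either \<open>d\<close> heavy nodes, or \<open>d - 1\<close> of them and the unit
  kept back for a free node at the pick of \<open>mt (u i)\<close>.\<close>

lemma leaf_slack:
  assumes i: "i < n" and lf: "leaf i"
  shows "int d - 2 - int (card (heavy i)) \<le> slack i"
    and "slack i < 0 \<Longrightarrow> - 1 \<le> slack i \<and> d \<le> card (heavy i) + 1 \<and>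
      (d \<le> card (heavy i) \<or> (\<tau> (mt (u i)) < i \<and> has_free (\<tau> (mt (u i)))))"
proof -
  have nb: "mt (u i) \<notin> nb i (u i) - {v i}" using nb_leaf[OF i lf] by auto
  note c = min_degree_mate_cases[OF i nb]
  note L = load_le[OF i] card_loaded_leaf[OF i lf] card_heavy_loaded[of i] weight_ge(1)[of "v i"]
  have v: "2 * int d \<le> weight (v i) \<or> card (loaded i) + 1 \<le> d" if "mt (v i) \<noteq> u i"
    using that L(3) pick_props[OF i] i by (cases "mt (v i) = v i") (auto simp: weight_def free_def)
  have "int d - 2 - int (card (heavy i)) \<le> slack i \<and>
    (slack i < 0 \<longrightarrow> - 1 \<le> slack i \<and> d \<le> card (heavy i) + 1 \<and>
      (d \<le> card (heavy i) \<or> (\<tau> (mt (u i)) < i \<and> has_free (\<tau> (mt (u i))))))"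
    using i c
  proof (cases rule: weight_u_cases)
    case C
    then have "0 \<le> slack i" "int d - 2 - int (card (heavy i)) \<le> slack i"
      using v[OF C(2)] L(1,2,4,5) d_ge unfolding slack_def by linarith+
    then show ?thesis by simp
  next
    case single
    have "int d - 2 - int (card (heavy i)) \<le> slack i" "- 1 \<le> slack i" "slack i < 0 \<Longrightarrow> d \<le> card (heavy i)"
      using L(1,2,4,5) single(1,2) d_ge unfolding slack_def by linarith+
    then show ?thesis by auto
  next
    case later
    define f where "f = has_free (\<tau> (mt (u i)))"
    have wu: "weight (u i) = 2 * int d - 1 \<or> f \<and> weight (u i) = 2 * int d - 2"
      using later(1) by (cases f) (auto simp: f_def)
    have "int d - 2 - int (card (heavy i)) \<le> slack i" "- 1 \<le> slack i" "slack i < 0 \<Longrightarrow> d \<le> card (heavy i) + 1"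
      "slack i < 0 \<Longrightarrow> f"
      using v[OF later(3)] wu L(1,2,4,5) d_ge unfolding slack_def by linarith+
    then show ?thesis using later(2) by (auto simp: f_def)
  qed
  then show "int d - 2 - int (card (heavy i)) \<le> slack i"
    "slack i < 0 \<Longrightarrow> - 1 \<le> slack i \<and> d \<le> card (heavy i) + 1 \<and>
      (d \<le> card (heavy i) \<or> (\<tau> (mt (u i)) < i \<and> has_free (\<tau> (mt (u i)))))" by blast+
qed

text \<open>The pick removes the last edges of \<open>w\<close>, so \<open>w\<close> has current
  degree at most two. Minimality of the degree of \<open>u i\<close>, which is at least two, then
  makes \<open>w\<close> adjacent to both ends and leaves \<open>u i\<close> only the neighbors
  \<open>v i\<close> and \<open>w\<close>.\<close>

lemma nonleaf_load:
  assumes i: "i < n" and nl: "\<not> leaf i" and w: "w \<in> loaded i"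
  shows "nb i (u i) = {v i, w}" "w \<noteq> mt (u i)" "w \<noteq> v i"
proof -
  have W: "w \<in> W" "0 < load w i" using w by (auto simp: loaded_def)
  note p = pick_props[OF i]
  have z: "dg (Suc i) w = 0" and a: "\<tau> (mt w) < i" "u i \<in> N w \<or> v i \<in> N w"
    using l_nonleaf[OF W(1) i W(2) nl] l_adj[OF W(1) i W(2)] by auto
  have "\<exists>b. b \<in> nb i w" using a(2) p by (auto simp: nb_def)
  then obtain b where "b \<in> nb i w" ..
  then have "dg i (u i) \<le> dg i w" using dg_le[OF i] W i by (auto simp: W_def)
  then have g: "2 \<le> card (N w \<inter> {u i, v i})" "dg i (u i) \<le> card (N w \<inter> {u i, v i})"
    using not_leaf_iff[OF i] nl dg_split[OF i, of w] z by auto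
  then have uN: "u i \<in> N w" and d2: "dg i (u i) = 2"
    using card_pick_le1[of i w] card_pick_le[of w i] not_leaf_iff[OF i] nl by fastforce+
  show wv: "w \<noteq> v i" using W p i by (auto simp: W_def)
  have "{v i, w} \<subseteq> nb i (u i)"
    using v_in_nb[OF i] uN N_sym W i by (auto simp: nb_def W_def)
  then show "nb i (u i) = {v i, w}"
    using d2 finite_nb wv unfolding dg_def by (metis card_2_iff card_subset_eq)
  show "w \<noteq> mt (u i)" using a(1) mt_mt p by auto
qed

text \<open>A loaded pick has a single loaded node with at most two units against a weight of at
  least \<open>2 * d - 3\<close>, a surplus as \<open>d \<ge> 3\<close>. An unloaded half pick
  balances exactly. In other unloaded picks without surplus no end earns the large reward, so both
  partners come later, and the unit kept by the end that is not free pays for a free one.\<close>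

lemma nonleaf_slack:
  assumes i: "i < n" and nl: "\<not> leaf i"
  shows "0 \<le> slack i"
    and "slack i < 1 \<Longrightarrow> \<not> half i \<Longrightarrow> i < \<tau> (mt (u i)) \<and> i < \<tau> (mt (v i)) \<and>
      (\<forall>a\<in>{u i, v i}. free a \<longrightarrow> dg (Suc i) (mt a) = 0)"
proof -
  note p = pick_props[OF i]
  have "0 \<le> slack i \<and> (slack i < 1 \<longrightarrow> \<not> half i \<longrightarrow> i < \<tau> (mt (u i)) \<and> i < \<tau> (mt (v i)) \<and>
      (\<forall>a\<in>{u i, v i}. free a \<longrightarrow> dg (Suc i) (mt a) = 0))"
  proof (cases "loaded i = {}")
    case False
    then obtain w where w: "w \<in> loaded i" by blast
    have "loaded i = {w}" using nonleaf_load(1,3)[OF i nl] w by blast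
    then have ld: "(\<Sum>w\<in>W. load w i) \<le> 2" using load_le[OF i] card_heavy_loaded[of i] by simp
    have nb: "mt (u i) \<notin> nb i (u i) - {v i}"
      using nonleaf_load[OF i nl w] by auto
    have "1 \<le> slack i"
      using i min_degree_mate_cases[OF i nb]
    proof (cases rule: weight_u_cases)
      case later
      have "2 * int d - 2 \<le> weight (u i)" using later(1) by simp
      then show ?thesis using weight_ge(1)[of "v i"] d_ge ld unfolding slack_def by linarith
    qed (use weight_ge(1)[of "v i"] d_ge ld in \<open>unfold slack_def, linarith+\<close>)
    then show ?thesis by simp
  next
    case True
    then have "\<forall>w\<in>W. load w i = 0" by (auto simp: loaded_def)
    then have sl: "slack i = weight (u i) + weight (v i)" by (simp add: slack_def)
    show ?thesis
    proof (cases "half i")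
      case True
      then have "slack i = 0" using sl demand_half[OF i True] by (simp add: weight_def half_def)
      then show ?thesis using True by simp
    next
      case nh: False
      show ?thesis
      proof (cases "mt (u i) = v i")
        case True
        then have "mt (v i) = u i" using mt_mt by metis
        then have "weight (u i) = 2 * int d - 1" "weight (v i) = 0"
          using True p u_neq_v[OF i] i by (auto simp: weight_def free_def)
        then show ?thesis using sl d_ge by simp
      next
        case ns: False
        have node: "2 * int d - 2 \<le> weight a \<or> i < \<tau> (mt a) \<and>
            (free a \<and> weight a = int (demand (mt a)) - 1 \<or> \<not> free a \<and> weight a = of_bool (has_free i))"
          if "a = u i \<or> a = v i" for a
        proof -
          have t: "\<tau> a = i" "a \<in> V" using that p by auto
          have "mt a = a" if "\<tau> (mt a) = i"
            using that \<open>a = u i \<or> a = v i\<close> ns in_pick[of "mt a"] mt_in_V[OF t(2)] i mt_mt by metis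
          then show ?thesis using t i d_ge by (auto simp: weight_def free_def)
        qed
        \<comment> \<open>The partner of a free end always asks for a unit unless the pick isolates
          it.\<close>
        have D0: "dg (Suc i) (mt a) = 0" if "a = u i \<or> a = v i" "free a" "demand (mt a) = 0" for a
        proof -
          have t: "\<tau> a = i" "a \<in> V" using that p by auto
          then have "mt a \<noteq> a" using free_mt that(2) i by blast
          then show ?thesis using that(3) t by (auto simp: demand_def Let_def mt_mt split: if_splits)
        qed
        show ?thesis
          using node[of "u i"] node[of "v i"] D0[of "u i"] D0[of "v i"] weight_ge(1)[of "u i"]
            weight_ge(1)[of "v i"] d_ge sl nh
          by (cases "free (u i)"; cases "free (v i)") (auto simp: half_def has_free_def)
      qed
    qed
  qed
  note main = this
  show "0 \<le> slack i" by (rule conjunct1[OF main])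
  show "i < \<tau> (mt (u i)) \<and> i < \<tau> (mt (v i)) \<and>
      (\<forall>a\<in>{u i, v i}. free a \<longrightarrow> dg (Suc i) (mt a) = 0)" if "slack i < 1" "\<not> half i"
    using main that by simp
qed

section \<open>Picks with a deficit and the picks that pay for them\<close>

lemma leaf_after_phase: "phase T p \<Longrightarrow> leaf p \<Longrightarrow> leaf (Suc T)"
  unfolding phase_def by (metis Suc_lessI lessI)

text \<open>Before pick \<open>T\<close> all non-isolated nodes have degree at least two, so a node
  of degree one afterwards lost an edge to the pick.\<close>

lemma outer_neighbor:
  assumes T: "T < n" and x: "x \<in> V" "T < \<tau> x" and d1: "dg (Suc T) x = 1" and nl: "\<not> leaf T"
  shows "x \<in> outer T" "dg T (u T) \<le> 1 + card (N x \<inter> {u T, v T})"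
proof -
  note p = pick_props[OF T]
  obtain b where "b \<in> nb (Suc T) x" using d1 unfolding dg_def by (metis card_1_singletonE insertI1)
  then have "b \<in> nb T x" by (auto simp: nb_def)
  then have "dg T (u T) \<le> dg T x" using dg_le T x by simp
  then show le: "dg T (u T) \<le> 1 + card (N x \<inter> {u T, v T})" using dg_split[OF T, of x] d1 by simp
  then have "card (N x \<inter> {u T, v T}) \<noteq> 0" using nl not_leaf_iff[OF T] by linarith
  then have "N x \<inter> {u T, v T} \<noteq> {}" by (metis card.empty)
  then show "x \<in> outer T" using p x N_sym by (auto simp: outer_def nb_def)
qed

lemma heavy_urgent:
  assumes "p < n" "leaf p" "phase T p" "w \<in> heavy p"
  shows "w \<in> W" "demand w = 2" "dg (Suc T) w = 1" "\<tau> (mt w) \<le> T" "v p \<in> nb (Suc T) w"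
proof -
  show W: "w \<in> W" using assms by (auto simp: heavy_def)
  have "urgent w p" using assms l_urgent by (auto simp: heavy_def)
  then show "demand w = 2" "dg (Suc T) w = 1" "\<tau> (mt w) \<le> T"
    using phase_unique[OF assms(3)] unfolding urgent_def by blast+
  have "w \<in> N (v p)" using assms loaded_leaf[of p] by (auto simp: heavy_def loaded_def)
  then show "v p \<in> nb (Suc T) w"
    using N_sym pick_props[OF assms(1)] assms(3) by (auto simp: nb_def phase_def)
qed

text \<open>The heavy nodes and \<open>u (Suc T)\<close> have degree one after pick
  \<open>T\<close>, so all are next to it. Were the minimum degree at \<open>T\<close> larger than
  two, it would be three with each of them adjacent to both ends; two heavy nodes,
  \<open>u (Suc T)\<close> and \<open>v T\<close> would then be four neighbors of
  \<open>u T\<close>. So \<open>u T\<close> contributes one node to \<open>outer T\<close> and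
  \<open>v T\<close> at most \<open>d\<close>.\<close>

lemma critical_setup:
  assumes p: "p < n" "leaf p" "phase T p" and cU: "d \<le> card (heavy p) + 1"
  shows "T < n" "Suc T < n" "\<not> leaf T" "leaf (Suc T)" "dg T (u T) = 2" "heavy p \<subseteq> outer T"
    "u (Suc T) \<in> outer T" "u (Suc T) \<notin> W" "card (outer T) \<le> d + 1" "card (nb T (v T) - {u T}) \<le> d"
proof -
  show Tn: "T < n" and qn: "Suc T < n" and nl: "\<not> leaf T"
    using p unfolding phase_def by auto
  show lq: "leaf (Suc T)" using leaf_after_phase p by blast
  define q where "q = u (Suc T)"
  have q: "q \<in> V" "\<tau> q = Suc T" "dg (Suc T) q = 1"
    using pick_props[OF qn] lq by (auto simp: q_def leaf_def)
  note pT = pick_props[OF Tn]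
  show UX: "heavy p \<subseteq> outer T" and qX: "u (Suc T) \<in> outer T"
    using outer_neighbor(1)[OF Tn _ _ _ nl] heavy_urgent[OF p] q Tn by (auto simp: W_def q_def)
  show qW: "u (Suc T) \<notin> W" using q qn by (auto simp: W_def q_def)
  have "2 \<le> card (heavy p)" using cU d_ge by linarith
  then obtain A where A: "A \<subseteq> heavy p" "card A = 2" by (meson obtain_subset_with_card_n)
  then obtain x y where xy: "A = {x, y}" "x \<noteq> y" by (auto simp: card_2_iff)
  then have xyU: "x \<in> heavy p" "y \<in> heavy p" using A by auto
  have le: "dg T (u T) \<le> 1 + card (N z \<inter> {u T, v T})" if "z \<in> {x, y, q}" for z
    using outer_neighbor(2)[OF Tn _ _ _ nl, of z] heavy_urgent[OF p] xyU q Tn that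
    by (auto simp: W_def)
  show d2: "dg T (u T) = 2"
  proof (rule ccontr)
    assume "dg T (u T) \<noteq> 2"
    then have d3: "3 \<le> dg T (u T)" using nl not_leaf_iff[OF Tn] by simp
    have both: "u T \<in> N z \<and> dg T (u T) = 3" if "z \<in> {x, y, q}" for z
      using le[OF that] d3 card_pick_le1[of T z] card_pick_le[of z T] by fastforce
    have t: "T < \<tau> z" if "z \<in> {x, y, q}" for z
      using that heavy_urgent(1)[OF p] xyU q Tn by (auto simp: W_def)
    have "{x, y, q, v T} \<subseteq> nb T (u T)"
      using both t v_in_nb[OF Tn] N_sym by (auto simp: nb_def less_imp_le)
    then have "card {x, y, q, v T} \<le> 3"
      using both[of q] card_mono[OF finite_nb] unfolding dg_def by (metis insertCI)
    moreover have "x \<noteq> q" "y \<noteq> q" using qW heavy_urgent(1)[OF p] xyU by (auto simp: q_def)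
    moreover have "v T \<notin> {x, y, q}" using t[of "v T"] pT by auto
    ultimately show False using xy(2) by (auto simp: card_insert_if)
  qed
  have "card (nb T (u T) - {v T}) = 1"
    using d2 v_in_nb[OF Tn] finite_nb by (simp add: dg_def)
  moreover show "card (nb T (v T) - {u T}) \<le> d"
  proof -
    have "card (nb T (v T)) \<le> card (N (v T))" using finite_N by (intro card_mono) (auto simp: nb_def)
    then show ?thesis using u_in_nb[OF Tn] finite_nb N_card[of "v T"] by simp
  qed
  moreover have "outer T \<subseteq> (nb T (u T) - {v T}) \<union> (nb T (v T) - {u T})" by (auto simp: outer_def)
  then have "card (outer T) \<le> card ((nb T (u T) - {v T}) \<union> (nb T (v T) - {u T}))"
    using finite_nb by (intro card_mono) auto
  ultimately show "card (outer T) \<le> d + 1"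
    using card_Un_le[of "nb T (u T) - {v T}" "nb T (v T) - {u T}"] by linarith
qed

text \<open>In a half pick the only neighbor of \<open>u T\<close> besides \<open>v T\<close> is its
  partner \<open>w1\<close>, which is never heavy since demand two sits at partners of some
  \<open>v i\<close>. So the heavy nodes and \<open>u (Suc T)\<close> already fill the at most
  \<open>d\<close> places of \<open>R\<close>, and one more node of \<open>R\<close> gives the
  contradiction.\<close>

lemma critical_not_half:
  assumes p: "p < n" "leaf p" "phase T p" and cU: "d \<le> card (heavy p) + 1"
  shows "\<not> half T"
proof
  assume h: "half T"
  note S = critical_setup[OF p cU]
  note hf = half_facts[OF S(1) h] and pT = pick_props[OF S(1)]
  define w1 w2 R where "w1 = mt (u T)" and "w2 = mt (v T)" and "R = nb T (v T) - {u T}"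
  have fu: "free (u T)" "free (v T)" using h by (auto simp: half_def)
  have w1: "w1 \<in> nb T (u T)" "w1 \<noteq> v T" "w1 \<in> W"
    using free_in_nb[OF pT(1) _ fu(1) S(1)] hf pT S(1) by (auto simp: w1_def W_def)
  have w2: "w2 \<in> R"
    using free_in_nb[OF pT(2) _ fu(2) S(1)] hf pT S(1) by (auto simp: w2_def W_def R_def)
  have nbu: "nb T (u T) = {v T, w1}"
    using S(5) v_in_nb[OF S(1)] w1 finite_nb unfolding dg_def
    by (intro card_seteq[symmetric]) auto
  have cR: "card R \<le> d" using S(10) by (simp add: R_def)
  have fR: "finite R" by (simp add: R_def finite_nb)
  have w1U: "w1 \<notin> heavy p"
  proof
    assume "w1 \<in> heavy p"
    then have "demand w1 = 2" "w1 \<in> W" using heavy_urgent[OF p] by auto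
    then have "w1 = mt (v (\<tau> (mt w1)))" using demand_2 by blast
    then show False using hf(1) pT(3) by (simp add: w1_def mt_mt)
  qed
  have sub: "insert (u (Suc T)) (heavy p) \<subseteq> R"
    using S(6,7,8) w1U w1(3) nbu unfolding outer_def R_def by auto
  \<comment> \<open>The extra node is \<open>w2\<close>, unless \<open>w2\<close> is heavy; then its
    demand of two means that the pick isolated \<open>w1\<close>, which is therefore adjacent to
    \<open>v T\<close>.\<close>
  have "\<exists>y \<in> R. y \<notin> heavy p \<and> y \<noteq> u (Suc T)"
  proof (cases "w2 \<in> heavy p")
    case False
    then show ?thesis using w2 hf(2) S(8) by (auto simp: w2_def)
  next
    case True
    then have "demand w2 = 2" "w2 \<in> W" using heavy_urgent[OF p] by auto
    then have "dg (Suc T) w1 = 0" using demand_2(5)[of w2] pT(4) by (simp add: w2_def w1_def mt_mt)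
    then have "w1 \<in> R" using hf(5) w1 pT S(1) by (auto simp: R_def nb_def w1_def W_def)
    then show ?thesis using w1U w1 S(8) by blast
  qed
  then obtain y where y: "y \<in> R" "y \<notin> heavy p" "y \<noteq> u (Suc T)" by blast
  then have "card (insert y (insert (u (Suc T)) (heavy p))) \<le> card R"
    using sub fR by (intro card_mono) auto
  moreover have "u (Suc T) \<notin> heavy p" using S(8) by (auto simp: heavy_def)
  ultimately show False using y cU cR finite_W by simp
qed

text \<open>Without surplus at \<open>T\<close>, the partners \<open>mu\<close> and
  \<open>mv\<close> of its ends are later, lie in \<open>outer T\<close> and are not heavy. With at
  least \<open>d - 1\<close> heavy nodes they exhaust \<open>outer T\<close>, so
  \<open>u (Suc T)\<close> is one of them. This leaves neither a heavy node for \<open>Suc T\<close>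
  nor, if \<open>p = Suc T\<close>, a reason for the deficit of \<open>p\<close>.\<close>

lemma critical_credit:
  assumes p: "p < n" "leaf p" "phase T p" and sp: "slack p < 0"
  shows "1 \<le> slack T \<or> Suc T < p \<and> 1 \<le> slack (Suc T)"
proof (rule ccontr)
  assume neg: "\<not> ?thesis"
  have cU: "d \<le> card (heavy p) + 1" and ty: "d \<le> card (heavy p) \<or> \<tau> (mt (u p)) < p \<and> has_free (\<tau> (mt (u p)))"
    using leaf_slack(2)[OF p(1,2) sp] by auto
  note S = critical_setup[OF p cU] and pT = pick_props[OF critical_setup(1)[OF p cU]]
  have nh: "\<not> half T" by (rule critical_not_half[OF p cU])
  define q where "q = u (Suc T)"
  have ex: "T < \<tau> (mt (u T))" "T < \<tau> (mt (v T))"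
    "\<And>a. a = u T \<or> a = v T \<Longrightarrow> free a \<Longrightarrow> dg (Suc T) (mt a) = 0"
    using nonleaf_slack(2)[OF S(1,3) _ nh] neg by auto
  define mu mv where "mu = mt (u T)" and "mv = mt (v T)"
  have mne: "mu \<noteq> u T" "mv \<noteq> v T" "mu \<noteq> v T" "mv \<noteq> u T"
    using ex pT by (auto simp: mu_def mv_def)
  have mm: "mu \<noteq> mv" using mt_mt u_neq_v[OF S(1)] unfolding mu_def mv_def by metis
  have mX: "mu \<in> outer T" "mv \<in> outer T"
    using mne ex mt_in_N[of "u T"] mt_in_N[of "v T"] by (auto simp: outer_def nb_def mu_def mv_def)
  have notU: "x \<notin> heavy r" if x: "x = mu \<or> x = mv" and r: "r < n" "leaf r" "phase T r" for x r
  proof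
    assume "x \<in> heavy r"
    then have "demand x = 2" "x \<in> W" using heavy_urgent[OF r] by auto
    then have "half (\<tau> (mt x))" using demand_2 by blast
    then show False using nh x pT by (auto simp: mu_def mv_def mt_mt)
  qed
  have qU: "q \<notin> heavy r" for r using S(8) by (auto simp: heavy_def q_def)
  have qX: "q \<in> outer T" using S(7) by (simp add: q_def)
  have fX: "finite (outer T)" by (rule finite_W)
  have full': "insert x (insert y (heavy p)) \<subset> outer T \<Longrightarrow> x \<noteq> y \<Longrightarrow> x \<notin> heavy p \<Longrightarrow> y \<notin> heavy p \<Longrightarrow> False" for x y
    using psubset_card_mono[OF fX, of "insert x (insert y (heavy p))"] S(9) cU finite_W by simp
  have full: "insert x (insert y (heavy p)) = outer T"
    if "x \<noteq> y" "x \<notin> heavy p" "y \<notin> heavy p" "x \<in> outer T" "y \<in> outer T" for x y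
    using full'[of x y] that S(6) by blast
  have muv: "mu \<notin> heavy p" "mv \<notin> heavy p" using notU p by auto
  have Xeq: "insert mu (insert mv (heavy p)) = outer T" using full[OF mm muv mX] .
  then have q_in: "q = mu \<or> q = mv" using qX qU by blast
  show False
  proof (cases "Suc T < p")
    case True
    have phq: "phase T (Suc T)" using S(3) by (auto simp: phase_def)
    have "slack (Suc T) < 1" using neg True by auto
    \<comment> \<open>An unloaded second unit everywhere would leave at least
      \<open>d - 2 \<ge> 1\<close>.\<close>
    then have "heavy (Suc T) \<noteq> {}" using leaf_slack(1)[OF S(2,4)] d_ge by auto
    then obtain w where w: "w \<in> heavy (Suc T)" by blast
    note uw = heavy_urgent[OF S(2,4) phq w]
    have "w \<in> outer T" using outer_neighbor(1)[OF S(1) _ _ uw(3) S(3)] uw(1) S(1) by (auto simp: W_def)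
    moreover have "w \<notin> heavy p"
    proof
      assume "w \<in> heavy p"
      then have "v p \<in> nb (Suc T) w" using heavy_urgent[OF p] by blast
      \<comment> \<open>The single edge of \<open>w\<close> left after \<open>T\<close> would have
        to end in both picks.\<close>
      then have "v p = v (Suc T)" using uw(3,5) unfolding dg_def by (metis card_1_singletonE singletonD)
      then show False using True pick_props[OF p(1)] pick_props[OF S(2)] by simp
    qed
    ultimately have "w = mu \<or> w = mv" using Xeq by blast
    then show False using notU S(2,4) phq w by blast
  next
    case False
    then have pq: "p = Suc T" using p(3) by (simp add: phase_def)
    have "card (outer T) = card (heavy p) + 2" using Xeq[symmetric] mm muv finite_W by simp
    then have "\<not> d \<le> card (heavy p)" using S(9) by linarith
    moreover have "\<tau> (mt (u p)) = T" using q_in pT by (auto simp: q_def pq mu_def mv_def mt_mt)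
    \<comment> \<open>There are exactly \<open>d - 1\<close> heavy nodes, so the deficit must come
      from a free node at pick \<open>T\<close>. Its partner is isolated by \<open>T\<close>, hence
      adjacent to both ends, and \<open>outer T\<close> shrinks to at most \<open>d\<close> nodes,
      one too few.\<close>
    ultimately have hf: "has_free T" using ty by simp
    obtain a where a: "a = u T \<or> a = v T" "free a" using hf by (auto simp: has_free_def)
    define w where "w = mt a"
    have fm: "mt a \<noteq> a" "w \<in> N a" "w \<in> W" using free_mt[of a] a pT S(1) by (auto simp: w_def)
    have dz: "dg (Suc T) w = 0" using ex(3)[OF a] by (simp add: w_def)
    have "a \<in> nb T w" using fm(2) a pT N_sym by (auto simp: nb_def)
    then have "dg T (u T) \<le> dg T w" using dg_le[OF S(1)] fm(3) S(1) by (auto simp: W_def)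
    then have "2 \<le> card (N w \<inter> {u T, v T})" using dg_split[OF S(1), of w] dz S(5) by simp
    then have both: "u T \<in> N w" "v T \<in> N w" using card_pick_le1[of T w] by fastforce+
    have wv: "w \<noteq> v T" using fm(3) pT S(1) by (auto simp: W_def)
    have inb: "w \<in> nb T (u T)" "w \<in> nb T (v T) - {u T}"
      using both N_sym fm(3) pT S(1) by (auto simp: nb_def W_def)
    then have "nb T (u T) = {v T, w}"
      using S(5) v_in_nb[OF S(1)] finite_nb wv unfolding dg_def
      by (intro card_seteq[symmetric]) auto
    then have "outer T \<subseteq> nb T (v T) - {u T}" using inb(2) by (auto simp: outer_def)
    then have "card (outer T) \<le> card (nb T (v T) - {u T})" using finite_nb by (intro card_mono) auto
    then show ?thesis using \<open>card (outer T) = card (heavy p) + 2\<close> cU S(10) by linarith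
  qed
qed

text \<open>The only edge of a heavy node after \<open>T\<close> leads to the pick it is heavy for,
  so the heavy sets are disjoint. Together with \<open>u (Suc T)\<close> they would put
  \<open>2 * (d - 1) + 1 > d + 1\<close> nodes into \<open>outer T\<close>.\<close>

lemma critical_unique:
  assumes p: "p < n" "leaf p" "phase T p" "slack p < 0" and r: "r < n" "leaf r" "phase T r" "slack r < 0"
  shows "p = r"
proof (rule ccontr)
  assume ne: "p \<noteq> r"
  have cp: "d \<le> card (heavy p) + 1" and cr: "d \<le> card (heavy r) + 1"
    using leaf_slack(2) p r by blast+
  note S = critical_setup[OF p(1-3) cp] and S' = critical_setup[OF r(1-3) cr]
  have "heavy p \<inter> heavy r = {}"
  proof (rule ccontr)
    assume "heavy p \<inter> heavy r \<noteq> {}"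
    then obtain w where w: "w \<in> heavy p" "w \<in> heavy r" by blast
    then have "v p = v r" using heavy_urgent(3,5)[OF p(1-3) w(1)] heavy_urgent(5)[OF r(1-3) w(2)]
      unfolding dg_def by (metis card_1_singletonE singletonD)
    then show False using ne pick_props[OF p(1)] pick_props[OF r(1)] by simp
  qed
  then have "card (insert (u (Suc T)) (heavy p \<union> heavy r)) = card (heavy p) + card (heavy r) + 1"
    using S(8) finite_W by (auto simp: card_Un_disjoint heavy_def)
  moreover have "card (insert (u (Suc T)) (heavy p \<union> heavy r)) \<le> card (outer T)"
    using S(6,7) S'(6) finite_W by (intro card_mono) auto
  ultimately show False using cp cr S(9) d_ge by linarith
qed

lemma sum_slack_nonneg: "0 \<le> (\<Sum>i<n. slack i)"
proof -
  define C where "C = {p. p < n \<and> slack p < 0}"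
  have lf: "leaf p" if "p \<in> C" for p using that nonleaf_slack(1)[of p] by (auto simp: C_def)
  have "\<forall>p\<in>C. \<exists>T. phase T p"
  proof
    fix p assume p: "p \<in> C"
    then have "d \<le> card (heavy p) + 1" using leaf_slack(2)[of p] lf by (auto simp: C_def)
    then have "heavy p \<noteq> {}" using d_ge by auto
    then obtain w where "w \<in> heavy p" by blast
    then have "urgent w p" using l_urgent p lf by (auto simp: heavy_def C_def)
    then show "\<exists>T. phase T p" by (auto simp: urgent_def)
  qed
  then obtain T where T: "\<And>p. p \<in> C \<Longrightarrow> phase (T p) p" by metis
  have uniq: "p = r" if "p \<in> C" "r \<in> C" "T p = T r" for p r
    using critical_unique[of p "T p" r] that T[OF that(1)] T[OF that(2)] lf by (auto simp: C_def)
  \<comment> \<open>\<open>c p\<close> is the pick whose surplus covers the deficit of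
    \<open>p\<close>. It is injective because \<open>T p\<close> can be recovered from it:
    \<open>T p\<close> is not a degree-one pick, while \<open>Suc (T p)\<close> is.\<close>
  define c where "c p = (if 1 \<le> slack (T p) then T p else Suc (T p))" for p
  have c1: "1 \<le> slack (c p)" "c p < p" and cl: "leaf (c p) \<longleftrightarrow> c p = Suc (T p)" if "p \<in> C" for p
  proof -
    have pC: "p < n" "slack p < 0" using that by (auto simp: C_def)
    note cc = critical_credit[OF pC(1) lf[OF that] T[OF that] pC(2)]
    show "1 \<le> slack (c p)" "c p < p" using cc T[OF that] by (auto simp: c_def phase_def)
    show "leaf (c p) \<longleftrightarrow> c p = Suc (T p)"
      using T[OF that] leaf_after_phase[OF T[OF that] lf[OF that]] by (auto simp: c_def phase_def)
  qed
  have inj: "inj_on c C"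
  proof
    fix p r assume pr: "p \<in> C" "r \<in> C" "c p = c r"
    have "T p = T r" using cl[OF pr(1)] cl[OF pr(2)] pr(3)
      by (cases "leaf (c p)") (auto simp: c_def split: if_splits)
    then show "p = r" using uniq pr by blast
  qed
  have fC: "finite C" by (simp add: C_def)
  have sub: "C \<union> c ` C \<subseteq> {..<n}" using c1 by (fastforce simp: C_def)
  have disj: "C \<inter> c ` C = {}" using c1 by (fastforce simp: C_def)
  have "0 \<le> (\<Sum>p\<in>C. slack p + slack (c p))"
  proof (rule sum_nonneg)
    fix p assume p: "p \<in> C"
    then have "- 1 \<le> slack p" using leaf_slack(2)[of p] lf by (auto simp: C_def)
    then show "0 \<le> slack p + slack (c p)" using c1 p by fastforce
  qed
  also have "\<dots> = sum slack C + sum slack (c ` C)" using inj by (simp add: sum.distrib sum.reindex)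
  also have "\<dots> = sum slack (C \<union> c ` C)" using fC disj by (simp add: sum.union_disjoint)
  also have "\<dots> \<le> sum slack {..<n}" using sub by (intro sum_mono2) (auto simp: C_def not_less)
  finally show ?thesis by simp
qed

lemma sum_wt_ge: "int (\<Sum>w\<in>W. demand w) \<le> (\<Sum>a | a \<in> V \<and> \<tau> a < n. weight a)"
proof -
  define Cov where "Cov = {a \<in> V. \<tau> a < n}"
  have "{a \<in> Cov. \<tau> a = i} = {u i, v i}" if "i < n" for i
    using \<tau>_pick[OF that] pick_props[OF that] that by (auto simp: Cov_def)
  then have "(\<Sum>i<n. weight (u i) + weight (v i)) = (\<Sum>i<n. sum weight {a \<in> Cov. \<tau> a = i})"
    using u_neq_v by (intro sum.cong) auto
  also have "\<dots> = sum weight Cov"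
    using finite_V by (intro sum.group) (auto simp: Cov_def)
  finally have c: "(\<Sum>i<n. weight (u i) + weight (v i)) = sum weight Cov" .
  have "(\<Sum>i<n. \<Sum>w\<in>W. load w i) = (\<Sum>w\<in>W. \<Sum>i<n. load w i)" by (rule sum.swap)
  also have "\<dots> = (\<Sum>w\<in>W. demand w)" using l_sum by (intro sum.cong) auto
  finally have "(\<Sum>i<n. \<Sum>w\<in>W. load w i) = (\<Sum>w\<in>W. demand w)" .
  moreover have "(\<Sum>i<n. slack i) = (\<Sum>i<n. weight (u i) + weight (v i)) - int (\<Sum>i<n. \<Sum>w\<in>W. load w i)"
    unfolding slack_def by (simp add: sum_subtractf)
  ultimately show ?thesis using sum_slack_nonneg c unfolding Cov_def by simp
qed

end

section \<open>Global count of the nodes covered by the maximum matching\<close>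

context greedy_run
begin

lemma sum_wt: "int (\<Sum>w\<in>W. demand w) \<le> (\<Sum>a | a \<in> V \<and> \<tau> a < n. weight a)"
proof -
  have "\<forall>w\<in>W. \<exists>f. is_load w f" using load_exists by blast
  then obtain load where "\<forall>w\<in>W. is_load w (load w)" unfolding bchoice_iff ..
  then interpret loaded_run V N n d \<tau> u v mt load by unfold_locales blast
  show ?thesis by (rule sum_wt_ge)
qed

text \<open>The nodes covered by \<open>M\<close> split into the free ones \<open>A\<close>, those
  with a covered partner \<open>B\<close>, and those missed by \<open>M\<^sup>*\<close>,
  \<open>C\<close>; so \<open>2 * n\<close> is the sum of their sizes, while
  \<open>M\<^sup>*\<close> covers \<open>2 * card A + card B\<close> nodes. In \<open>sum_wt\<close>
  the demands cancel and leave the cost of \<open>A\<close> against the earnings of \<open>B\<close>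
  and \<open>C\<close>.\<close>

lemma matched_nodes_le: "(2 * d + 1) * card {a \<in> V. mt a \<noteq> a} \<le> 8 * d * n"
proof -
  define Cov where "Cov = {a \<in> V. \<tau> a < n}"
  define A where "A = {a \<in> Cov. free a}"
  define B where "B = {a \<in> Cov. \<not> free a \<and> mt a \<noteq> a}"
  define C where "C = {a \<in> Cov. \<not> free a \<and> mt a = a}"
  have fin: "finite Cov" "finite A" "finite B" "finite C" "finite W"
    using finite_V by (auto simp: A_def B_def C_def Cov_def W_def)
  have "card Cov = (\<Sum>i<n. card {a \<in> Cov. \<tau> a = i})"
    using sum.group[OF fin(1), of "{..<n}" \<tau> "\<lambda>_. 1::nat"] by (simp add: Cov_def image_subset_iff)
  also have "\<dots> = (\<Sum>i<n. 2)"
  proof (rule sum.cong)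
    fix i assume "i \<in> {..<n}"
    then have "{a \<in> Cov. \<tau> a = i} = {u i, v i}" "u i \<noteq> v i"
      using \<tau>_pick[of i] pick_props[of i] u_neq_v[of i] by (auto simp: Cov_def)
    then show "card {a \<in> Cov. \<tau> a = i} = 2" by simp
  qed simp
  finally have cov: "card Cov = 2 * n" by simp
  have ABC: "Cov = A \<union> (B \<union> C)" "A \<inter> (B \<union> C) = {}" "B \<inter> C = {}"
    by (auto simp: A_def B_def C_def)
  have card_cov: "card Cov = card A + card B + card C"
    using ABC fin by (simp add: card_Un_disjoint)
  have sum_cov: "sum weight Cov = sum weight A + sum weight B + sum weight C"
    using ABC fin by (simp add: sum.union_disjoint)
  have inj: "inj mt" using mt_mt by (metis injI)
  have mtA: "mt ` A = {w \<in> W. mt w \<noteq> w}"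
  proof
    show "mt ` A \<subseteq> {w \<in> W. mt w \<noteq> w}"
      using free_mt mt_mt by (fastforce simp: A_def Cov_def)
    show "{w \<in> W. mt w \<noteq> w} \<subseteq> mt ` A"
    proof
      fix w assume "w \<in> {w \<in> W. mt w \<noteq> w}"
      then have "mt w \<in> A" using W_mt by (auto simp: A_def Cov_def)
      then show "w \<in> mt ` A" using mt_mt by (metis image_eqI)
    qed
  qed
  have "(\<Sum>w\<in>W. demand w) = (\<Sum>w | w \<in> W \<and> mt w \<noteq> w. demand w)"
    using fin by (intro sum.mono_neutral_right) (auto simp: demand_def)
  also have "\<dots> = (\<Sum>a\<in>A. demand (mt a))"
    unfolding mtA[symmetric] using inj by (subst sum.reindex) (auto intro: inj_on_subset)
  finally have DA: "(\<Sum>w\<in>W. demand w) = (\<Sum>a\<in>A. demand (mt a))" .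
  have "sum weight A = (\<Sum>a\<in>A. int (demand (mt a)) - 1)" by (rule sum.cong) (auto simp: A_def weight_def)
  then have sA: "sum weight A = int (\<Sum>w\<in>W. demand w) - int (card A)" by (simp add: DA sum_subtractf)
  have "sum weight C = (\<Sum>a\<in>C. 2 * int d)" by (rule sum.cong) (auto simp: C_def weight_def)
  then have sC: "sum weight C = 2 * int d * int (card C)" by simp
  have mtB: "mt a \<in> B" if "a \<in> B" for a
  proof -
    have a: "a \<in> V" "\<tau> a < n" "\<tau> (mt a) \<noteq> n" "mt a \<noteq> a" using that by (auto simp: B_def Cov_def free_def)
    then show ?thesis using mt_in_V[OF a(1)] \<tau>_le[of "mt a"]
      by (auto simp: B_def Cov_def free_def mt_mt)
  qed
  have "mt ` B = B" using mtB mt_mt by (metis image_subsetI image_eqI subsetI subset_antisym)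
  then have "sum weight B = (\<Sum>a\<in>B. weight (mt a))"
    using sum.reindex[of mt B weight] inj by (simp add: inj_on_subset)
  \<comment> \<open>\<open>B\<close> is closed under \<open>mt\<close>; doubling the sum pairs the
    ends of each edge, whose weights add up to \<open>2 * d - 1\<close>.\<close>
  then have "2 * sum weight B = (\<Sum>a\<in>B. weight a + weight (mt a))" by (simp add: sum.distrib)
  also have "\<dots> = (\<Sum>a\<in>B. 2 * int d - 1)"
  proof (rule sum.cong)
    fix a assume a: "a \<in> B"
    have t: "\<tau> a < n" "\<tau> (mt a) < n" "\<not> free a" "\<not> free (mt a)" "mt a \<noteq> a" "mt (mt a) \<noteq> mt a"
      "a \<in> V" "mt a \<in> V"
      using a mtB[OF a] by (auto simp: B_def Cov_def)
    show "weight a + weight (mt a) = 2 * int d - 1"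
    proof (cases "\<tau> (mt a) = \<tau> a")
      case True
      then have "(a = u (\<tau> a)) \<noteq> (mt a = u (\<tau> a))" using in_pick t by metis
      then show ?thesis using t True by (auto simp: weight_def mt_mt)
    qed (use t in \<open>auto simp: weight_def mt_mt\<close>)
  qed simp
  finally have sB: "2 * sum weight B = int (card B) * (2 * int d - 1)" by simp
  have "{a \<in> V. mt a \<noteq> a} = A \<union> (B \<union> mt ` A)"
    unfolding mtA using \<tau>_le free_mt
    by (fastforce simp: A_def B_def Cov_def W_def order_le_less)
  moreover have "B \<inter> mt ` A = {}" "A \<inter> (B \<union> mt ` A) = {}"
    unfolding mtA by (auto simp: A_def B_def Cov_def W_def)
  ultimately have "card {a \<in> V. mt a \<noteq> a} = 2 * card A + card B"
    using fin inj by (simp add: card_Un_disjoint card_image inj_on_subset)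
  moreover have "0 \<le> - 2 * int (card A) + (2 * int d - 1) * int (card B) + 4 * int d * int (card C)"
    using sum_wt sum_cov sA sB sC unfolding Cov_def by (simp add: algebra_simps)
  moreover have "8 * int d * int n = 4 * int d * (int (card A) + int (card B) + int (card C))"
  proof -
    have "int (card A) + int (card B) + int (card C) = 2 * int n" using cov card_cov by linarith
    then show ?thesis by simp
  qed
  ultimately have "int ((2 * d + 1) * card {a \<in> V. mt a \<noteq> a}) \<le> int (8 * d * n)"
    by (simp add: algebra_simps)
  then show ?thesis by (simp only: of_nat_le_iff)
qed

end

section \<open>Outcomes of MinGreedy as deterministic traces\<close>

text \<open>One outcome of the random choices, in the form required by \<open>greedy_run\<close>;
  the last clause says that no edge remains after \<open>n\<close> picks.\<close>

definition greedy_trace ::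
  "'a set \<Rightarrow> 'a set set \<Rightarrow> nat \<Rightarrow> ('a \<Rightarrow> nat) \<Rightarrow> (nat \<Rightarrow> 'a) \<Rightarrow> (nat \<Rightarrow> 'a) \<Rightarrow> bool" where
  "greedy_trace V E n \<tau> u v \<longleftrightarrow>
     (\<forall>a\<in>V. \<tau> a \<le> n) \<and>
     (\<forall>i<n. v i \<in> neighbors E (u i) \<and> {a \<in> V. \<tau> a = i} = {u i, v i} \<and>
       (\<forall>a b. i \<le> \<tau> a \<longrightarrow> b \<in> neighbors E a \<longrightarrow> i \<le> \<tau> b \<longrightarrow>
         card {b \<in> neighbors E (u i). i \<le> \<tau> b} \<le> card {b \<in> neighbors E a. i \<le> \<tau> b})) \<and>
     (\<forall>a b. b \<in> neighbors E a \<longrightarrow> \<tau> a < n \<or> \<tau> b < n)"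

lemma greedy_trace_step:
  assumes g: "finite_simple_graph V E" and u: "u0 \<in> min_degree_nodes V E" and v: "v0 \<in> neighbors E u0"
    and tr: "greedy_trace (V - {u0, v0}) (delete_nodes {u0, v0} E) n \<tau> u v"
  shows "greedy_trace V E (Suc n) (\<lambda>a. if a \<in> {u0, v0} then 0 else Suc (\<tau> a))
    (case_nat u0 u) (case_nat v0 v)"
proof -
  define \<tau>' where "\<tau>' = (\<lambda>a. if a \<in> {u0, v0} then 0 else Suc (\<tau> a))"
  define E' where "E' = delete_nodes {u0, v0} E"
  have E'_iff: "b \<in> neighbors E' a \<longleftrightarrow> b \<in> neighbors E a \<and> a \<notin> {u0, v0} \<and> b \<notin> {u0, v0}" for a b
    by (auto simp: E'_def delete_nodes_def neighbors_def)
  have V: "u0 \<in> V" "v0 \<in> V"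
    using u v g by (auto simp: min_degree_nodes_def non_isolated_def neighbors_def finite_simple_graph_def)
  \<comment> \<open>The ends of the new first pick get time \<open>0\<close>, so counting from time
    \<open>Suc i\<close> in the old graph is counting from time \<open>i\<close> after the
    deletion.\<close>
  have nbr: "{b \<in> neighbors E a. Suc i \<le> \<tau>' b} = {b \<in> neighbors E' a. i \<le> \<tau> b}"
    if "a \<notin> {u0, v0}" for a i
    using that by (auto simp: E'_iff \<tau>'_def)
  have min: "card (neighbors E u0) \<le> card (neighbors E a)" if "b \<in> neighbors E a" for a b
  proof -
    have "a \<in> non_isolated V E"
      using that g by (auto simp: non_isolated_def neighbors_def finite_simple_graph_def)
    then show ?thesis using u by (auto simp: min_degree_nodes_def node_degree_def)
  qed
  have tr1: "\<And>a. a \<in> V - {u0, v0} \<Longrightarrow> \<tau> a \<le> n"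
    and tr2: "\<And>i. i < n \<Longrightarrow> v i \<in> neighbors E' (u i)"
    and tr3: "\<And>i. i < n \<Longrightarrow> {a \<in> V - {u0, v0}. \<tau> a = i} = {u i, v i}"
    and tr4: "\<And>i a b. i < n \<Longrightarrow> i \<le> \<tau> a \<Longrightarrow> b \<in> neighbors E' a \<Longrightarrow> i \<le> \<tau> b \<Longrightarrow>
         card {b \<in> neighbors E' (u i). i \<le> \<tau> b} \<le> card {b \<in> neighbors E' a. i \<le> \<tau> b}"
    and tr5: "\<And>a b. b \<in> neighbors E' a \<Longrightarrow> \<tau> a < n \<or> \<tau> b < n"
    using tr unfolding greedy_trace_def E'_def by blast+
  have pick: "case_nat v0 v i \<in> neighbors E (case_nat u0 u i) \<and>
      {a \<in> V. \<tau>' a = i} = {case_nat u0 u i, case_nat v0 v i} \<and>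
      (\<forall>a b. i \<le> \<tau>' a \<longrightarrow> b \<in> neighbors E a \<longrightarrow> i \<le> \<tau>' b \<longrightarrow>
        card {b \<in> neighbors E (case_nat u0 u i). i \<le> \<tau>' b} \<le> card {b \<in> neighbors E a. i \<le> \<tau>' b})"
    if "i < Suc n" for i
  proof (cases i)
    case 0
    then show ?thesis using v V min by (auto simp: \<tau>'_def)
  next
    case (Suc j)
    then have j: "j < n" using that by simp
    have uj: "u j \<notin> {u0, v0}" using tr2[OF j] by (simp add: E'_iff)
    have "{a \<in> V. \<tau>' a = i} = {a \<in> V - {u0, v0}. \<tau> a = j}" using Suc by (auto simp: \<tau>'_def)
    moreover have "card {b \<in> neighbors E (u j). i \<le> \<tau>' b} \<le> card {b \<in> neighbors E a. i \<le> \<tau>' b}"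
      if h: "i \<le> \<tau>' a" "b \<in> neighbors E a" "i \<le> \<tau>' b" for a b
    proof -
      have ab: "a \<notin> {u0, v0}" "b \<notin> {u0, v0}" using h Suc by (auto simp: \<tau>'_def)
      then have "j \<le> \<tau> a" "j \<le> \<tau> b" "b \<in> neighbors E' a" using h Suc by (auto simp: \<tau>'_def E'_iff)
      then show ?thesis using tr4[OF j] nbr[OF uj, of j] nbr[OF ab(1), of j] Suc by simp
    qed
    ultimately show ?thesis using tr2[OF j] tr3[OF j] Suc by (auto simp: E'_iff)
  qed
  have "\<tau>' a < Suc n \<or> \<tau>' b < Suc n" if "b \<in> neighbors E a" for a b
    using that tr5[of b a] by (auto simp: \<tau>'_def E'_iff)
  moreover have "\<forall>a\<in>V. \<tau>' a \<le> Suc n" using tr1 by (auto simp: \<tau>'_def)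
  ultimately show ?thesis using pick unfolding greedy_trace_def \<tau>'_def[symmetric] by blast
qed

lemma mingreedy_from_trace:
  assumes "finite_simple_graph V E" "M' \<in> set_pmf (mingreedy_from V E M)"
  shows "\<exists>n \<tau> u v. greedy_trace V E n \<tau> u v \<and> M' = M \<union> (\<lambda>i. {u i, v i}) ` {..<n}"
  using assms
proof (induction "card V" arbitrary: V E M rule: less_induct)
  case less
  note g = less.prems(1)
  show ?case
  proof (cases "E = {}")
    case True
    then have "M' = M" using less.prems(2) by (simp add: mingreedy_from.simps)
    then show ?thesis using True
      \<comment> \<open>With \<open>n = 0\<close> every node gets time \<open>0 = n\<close>, that
        is, it is never matched.\<close>
      by (intro exI[of _ "0::nat"] exI[of _ "\<lambda>_. 0::nat"]) (simp add: greedy_trace_def neighbors_def)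
  next
    case False
    have "set_pmf (pmf_of_set (min_degree_nodes V E)) = min_degree_nodes V E"
      using g False by (intro set_pmf_of_set min_degree_nodes_nonempty finite_min_degree_nodes)
    then obtain u0 where u0: "u0 \<in> min_degree_nodes V E"
      and M1: "M' \<in> set_pmf (bind_pmf (pmf_of_set (neighbors E u0)) (\<lambda>v.
        mingreedy_from (V - {u0, v}) (delete_nodes {u0, v} E) (insert {u0, v} M)))"
      using less.prems(2) False g by (subst (asm) mingreedy_from.simps) auto
    have uV: "u0 \<in> V" "neighbors E u0 \<noteq> {}"
      using u0 by (auto simp: min_degree_nodes_def non_isolated_def)
    then have "set_pmf (pmf_of_set (neighbors E u0)) = neighbors E u0"
      using finite_neighbors[OF g] by (intro set_pmf_of_set)
    then obtain v0 where v0: "v0 \<in> neighbors E u0"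
      and M2: "M' \<in> set_pmf (mingreedy_from (V - {u0, v0}) (delete_nodes {u0, v0} E) (insert {u0, v0} M))"
      using M1 by auto
    have "card (V - {u0, v0}) < card V"
      using g uV by (intro psubset_card_mono) (auto simp: finite_simple_graph_def)
    then obtain n \<tau> u v where
      tr: "greedy_trace (V - {u0, v0}) (delete_nodes {u0, v0} E) n \<tau> u v"
      and M': "M' = insert {u0, v0} M \<union> (\<lambda>i. {u i, v i}) ` {..<n}"
      using less.hyps finite_simple_graph_delete[OF g] M2 by meson
    have "(\<lambda>i. {case_nat u0 u i, case_nat v0 v i}) ` {..<Suc n} =
        insert {u0, v0} ((\<lambda>i. {u i, v i}) ` {..<n})"
      unfolding lessThan_Suc_eq_insert_0 by (auto simp: image_image)
    then have "M' = M \<union> (\<lambda>i. {case_nat u0 u i, case_nat v0 v i}) ` {..<Suc n}" using M' by simp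
    with greedy_trace_step[OF g u0 v0 tr] show ?thesis by (intro exI conjI)
  qed
qed

section \<open>Matchings as involutions, and the bound for MinGreedy\<close>

text \<open>Fixing the uncovered nodes makes this a total involution, as needed for
  \<open>mt\<close>.\<close>

definition mate :: "'a set set \<Rightarrow> 'a \<Rightarrow> 'a" where
  "mate M a = (if \<exists>b. {a, b} \<in> M then THE b. {a, b} \<in> M else a)"

lemma mate_eq:
  assumes "disjoint M" "{a, b} \<in> M"
  shows "mate M a = b"
proof -
  have "c = b" if "{a, c} \<in> M" for c
    using disjointD[OF assms(1) that assms(2)] by (auto simp: doubleton_eq_iff)
  then have "(THE c. {a, c} \<in> M) = b" by (intro the_equality assms(2))
  then show ?thesis using assms(2) by (auto simp: mate_def)
qed

lemma mate_cases:
  assumes "disjoint M"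
  shows "{a, mate M a} \<in> M \<or> mate M a = a"
proof (cases "\<exists>b. {a, b} \<in> M")
  case True
  then show ?thesis using mate_eq[OF assms] by blast
qed (simp add: mate_def)

lemma mate_mate: "disjoint M \<Longrightarrow> mate M (mate M a) = a"
  using mate_cases[of M a] mate_eq[of M "mate M a" a] by (auto simp: insert_commute)

lemma card_matched_nodes:
  assumes g: "finite_simple_graph V E" and M: "matching E M"
  shows "card {a \<in> V. mate M a \<noteq> a} = 2 * card M"
proof -
  have sub: "M \<subseteq> {e. e \<subseteq> V \<and> card e = 2}" and dj: "disjoint M"
    using g M by (auto simp: finite_simple_graph_def matching_def)
  have "{a \<in> V. mate M a \<noteq> a} = \<Union>M"
  proof
    show "{a \<in> V. mate M a \<noteq> a} \<subseteq> \<Union>M" using mate_cases[OF dj] by blast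
    show "\<Union>M \<subseteq> {a \<in> V. mate M a \<noteq> a}"
    proof
      fix a assume "a \<in> \<Union>M"
      then obtain e where e: "e \<in> M" "a \<in> e" by blast
      then have "e \<subseteq> V" "card e = 2" using sub by auto
      then obtain b where "e = {a, b}" "a \<noteq> b" using e(2) by (auto simp: card_2_iff doubleton_eq_iff)
      then show "a \<in> {a \<in> V. mate M a \<noteq> a}" using mate_eq[OF dj] e \<open>e \<subseteq> V\<close> by auto
    qed
  qed
  moreover have "finite V" using g by (simp add: finite_simple_graph_def)
  then have "\<And>e. e \<in> M \<Longrightarrow> finite e" using sub by (auto intro: finite_subset)
  then have "card (\<Union>M) = sum card M"
    using dj by (intro card_Union_disjoint) (auto simp: disjoint_def pairwise_def disjnt_def)
  moreover have "sum card M = (\<Sum>e\<in>M. 2)" using sub by (intro sum.cong) auto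
  ultimately show ?thesis by simp
qed

theorem theorem4:
  fixes V :: "'a set" and E :: "'a set set" and \<Delta> :: nat
  assumes "\<Delta> \<ge> 4"
    and "finite_simple_graph V E"
    and "\<forall>u\<in>V. node_degree E u \<le> \<Delta>"
    and "M \<in> set_pmf (mingreedy V E)"
  shows "real (card M) \<ge> (2 * real \<Delta> - 1) / (4 * real \<Delta> - 4) * real (matching_number E)"
proof -
  define d where "d = \<Delta> - 1"
  have d: "\<Delta> = Suc d" "3 \<le> d" using assms(1) by (auto simp: d_def)
  have fV: "finite V" and edge: "\<And>e. e \<in> E \<Longrightarrow> e \<subseteq> V \<and> card e = 2"
    using assms(2) by (auto simp: finite_simple_graph_def)
  have fE: "finite E" using edge fV by (meson finite_Pow_iff finite_subset PowI subsetI)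
  have "{N. matching E N} \<subseteq> Pow E" by (auto simp: matching_def)
  then have "finite {N. matching E N}" using fE by (meson finite_Pow_iff finite_subset)
  moreover have "matching E {}" by (simp add: matching_def)
  ultimately have "matching_number E \<in> card ` {N. matching E N}"
    unfolding matching_number_def by (intro Max_in) auto
  then obtain Ms where Ms: "matching E Ms" "card Ms = matching_number E" by auto
  then have dj: "disjoint Ms" and MsE: "Ms \<subseteq> E" by (auto simp: matching_def)
  obtain n \<tau> u v where tr: "greedy_trace V E n \<tau> u v" and M: "M = (\<lambda>i. {u i, v i}) ` {..<n}"
    using mingreedy_from_trace[OF assms(2), of M "{}"] assms(4) by (auto simp: mingreedy_def)
  have tr1: "\<And>a. a \<in> V \<Longrightarrow> \<tau> a \<le> n"
    and tr2: "\<And>i. i < n \<Longrightarrow> v i \<in> neighbors E (u i)"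
    and tr3: "\<And>i. i < n \<Longrightarrow> {a \<in> V. \<tau> a = i} = {u i, v i}"
    and tr4: "\<And>i a b. i < n \<Longrightarrow> i \<le> \<tau> a \<Longrightarrow> b \<in> neighbors E a \<Longrightarrow> i \<le> \<tau> b \<Longrightarrow>
         card {b \<in> neighbors E (u i). i \<le> \<tau> b} \<le> card {b \<in> neighbors E a. i \<le> \<tau> b}"
    and tr5: "\<And>a b. b \<in> neighbors E a \<Longrightarrow> \<tau> a < n \<or> \<tau> b < n"
    using tr unfolding greedy_trace_def by blast+
  have irrefl: "a \<notin> neighbors E a" for a using edge[of "{a, a}"] by (auto simp: neighbors_def)
  have subV: "b \<in> neighbors E a \<Longrightarrow> a \<in> V \<and> b \<in> V" for a b
    using edge[of "{a, b}"] by (auto simp: neighbors_def)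
  interpret greedy_run V "neighbors E" n d \<tau> u v "mate Ms"
  proof
    show "card (neighbors E a) \<le> Suc d" for a
    proof (cases "a \<in> V")
      case True
      then show ?thesis using assms(3) d by (simp add: node_degree_def)
    next
      case False
      then have "neighbors E a = {}" using subV by blast
      then show ?thesis by simp
    qed
    show "a \<in> neighbors E b" if "b \<in> neighbors E a" for a b
      using that by (simp add: neighbors_def insert_commute)
    show "u i \<noteq> v i" if "i < n" for i using tr2[OF that] irrefl by metis
    show "\<tau> b < n" if "b \<in> neighbors E a" "\<tau> a = n" for a b using tr5[OF that(1)] that(2) by simp
    show "mate Ms a \<in> neighbors E a" if "mate Ms a \<noteq> a" for a
      using mate_cases[OF dj, of a] that MsE by (auto simp: neighbors_def)
  qed (use fV subV irrefl d tr1 tr2 tr3 tr4 mate_mate[OF dj] in auto)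
  \<comment> \<open>The time \<open>\<tau>\<close> of its ends determines a pick, so distinct picks
    give distinct edges and \<open>M\<close> has exactly \<open>n\<close> of them.\<close>
  have "inj_on (\<lambda>i. {u i, v i}) {..<n}"
    using tr3 by (intro inj_onI) (metis (mono_tags, lifting) insertI1 lessThan_iff mem_Collect_eq)
  then have "card M = n" using M by (simp add: card_image)
  \<comment> \<open>The maximum matching covers twice as many nodes as it has edges; with
    \<open>d = \<Delta> - 1\<close> the factors become \<open>2 * \<Delta> - 1\<close> and
    \<open>4 * \<Delta> - 4\<close>.\<close>
  moreover have "(2 * d + 1) * (2 * matching_number E) \<le> 8 * d * n"
    using matched_nodes_le card_matched_nodes[OF assms(2) Ms(1)] Ms(2) by simp
  then have "real ((2 * d + 1) * (2 * matching_number E)) \<le> real (8 * d * n)"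
    by (simp only: of_nat_le_iff)
  ultimately show ?thesis using d by (simp add: field_simps)
qed

end
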